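(* Let $\varrho>0$, let $\overline{u}\in L^2(\Omega)$, and let $(u_\varrho,p_\varrho)\in H^1_0(\Omega)\times H^1_0(\Omega)$ be the unique solution of the coupled variational formulation $$\frac1\varrho\langle p_\varrho,v\rangle_{L^2(\Omega)}+\langle\nabla u_\varrho,\nabla v\rangle_{L^2(\Omega)}=0\quad\text{for all }v\in H^1_0(\Omega),$$ $$\langle\nabla p_\varrho,\nabla q\rangle_{L^2(\Omega)}=\langle u_\varrho-\overline{u},q\rangle_{L^2(\Omega)}\quad\text{for all }q\in H^1_0(\Omega).$$ Then: (i) assuming only $\overline{u}\in L^2(\Omega)$, $$\|u_\varrho-\overline{u}\|_{L^2(\Omega)}\le\|\overline{u}\|_{L^2(\Omega)};$$ (ii) if $\overline{u}\in H^1_0(\Omega)$, then $$\|u_\varrho-\overline{u}\|_{L^2(\Omega)}\le\varrho^{1/4}\,\|\nabla\overline{u}\|_{L^2(\Omega)};$$ (iii) if $\overline{u}\in H^1_0(\Omega)$ satisfies $\Delta\overline{u}\in L^2(\Omega)$, then $$\|u_\varrho-\overline{u}\|_{L^2(\Omega)}\le\varrho^{1/2}\,\|\Delta\overline{u}\|_{L^2(\Omega)}.$$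
   Context: $\Omega\subset\mathbb{R}^d$, $d\in\{1,2,3\}$, is a bounded domain with Lipschitz boundary. All functions are real valued, $\langle\cdot,\cdot\rangle_{L^2(\Omega)}$ is the $L^2(\Omega)$ inner product (for scalar or vector fields), and $\Delta$ is the distributional Laplacian. The coupled system is the reduced optimality system of minimizing $\frac12\|u-\overline{u}\|^2_{L^2(\Omega)}+\frac\varrho2\|z\|^2_{L^2(\Omega)}$ subject to $-\Delta u=z$ in $\Omega$, $u=0$ on $\partial\Omega$; it has a unique solution. *)

theory Defs
  imports "HOL-Analysis.Analysis"
begin

(* Bounded Lipschitz domains: near each boundary point, after an orthonormal change of
   coordinates whose last axis is e, the set is the strict epigraph of a Lipschitz function g
   of the remaining coordinates, i.e. of a function on the hyperplane orthogonal to e. *)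

definition lipschitz_boundary :: "'a::euclidean_space set \<Rightarrow> bool" where
  "lipschitz_boundary \<Omega> \<longleftrightarrow>
     (\<forall>x\<in>frontier \<Omega>. \<exists>r>0. \<exists>e g L. norm e = 1 \<and> L-lipschitz_on {y. y \<bullet> e = 0} g \<and>
        \<Omega> \<inter> ball x r = {y \<in> ball x r. y \<bullet> e > (g (y - (y \<bullet> e) *\<^sub>R e) :: real)})"

definition bounded_lipschitz_domain :: "'a::euclidean_space set \<Rightarrow> bool" where
  "bounded_lipschitz_domain \<Omega> \<longleftrightarrow>
     open \<Omega> \<and> connected \<Omega> \<and> \<Omega> \<noteq> {} \<and> bounded \<Omega> \<and> lipschitz_boundary \<Omega>"

(* Elements of the function spaces below are functions on the whole space rather than
   equivalence classes; their values outside \<Omega> and on null sets are irrelevant. *)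

definition L2 :: "'a::euclidean_space set \<Rightarrow> ('a \<Rightarrow> 'b::euclidean_space) set" where
  "L2 \<Omega> = {f. f \<in> borel_measurable (lebesgue_on \<Omega>) \<and>
              integrable (lebesgue_on \<Omega>) (\<lambda>x. (norm (f x))\<^sup>2)}"

definition L2_inner ::
  "'a::euclidean_space set \<Rightarrow> ('a \<Rightarrow> 'b::euclidean_space) \<Rightarrow> ('a \<Rightarrow> 'b) \<Rightarrow> real" where
  "L2_inner \<Omega> f g = (LINT x|lebesgue_on \<Omega>. f x \<bullet> g x)"

definition L2_norm :: "'a::euclidean_space set \<Rightarrow> ('a \<Rightarrow> 'b::euclidean_space) \<Rightarrow> real" where
  "L2_norm \<Omega> f = sqrt (L2_inner \<Omega> f f)"

definition partial_deriv :: "'a::euclidean_space \<Rightarrow> ('a \<Rightarrow> real) \<Rightarrow> 'a \<Rightarrow> real" where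
  "partial_deriv i f x = frechet_derivative f (at x) i"

definition grad :: "('a::euclidean_space \<Rightarrow> real) \<Rightarrow> 'a \<Rightarrow> 'a" where
  "grad f x = (\<Sum>i\<in>Basis. partial_deriv i f x *\<^sub>R i)"

definition laplacian :: "('a::euclidean_space \<Rightarrow> real) \<Rightarrow> 'a \<Rightarrow> real" where
  "laplacian f x = (\<Sum>i\<in>Basis. partial_deriv i (partial_deriv i f) x)"

primrec Ck :: "nat \<Rightarrow> ('a::euclidean_space \<Rightarrow> real) \<Rightarrow> bool" where
  "Ck 0 f \<longleftrightarrow> continuous_on UNIV f"
| "Ck (Suc k) f \<longleftrightarrow>
     (\<forall>x. f differentiable (at x)) \<and> (\<forall>i\<in>Basis. Ck k (partial_deriv i f))"

definition test_functions :: "'a::euclidean_space set \<Rightarrow> ('a \<Rightarrow> real) set" where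
  "test_functions \<Omega> =
     {\<phi>. (\<forall>k. Ck k \<phi>) \<and> (\<exists>K. compact K \<and> K \<subseteq> \<Omega> \<and> (\<forall>x. x \<notin> K \<longrightarrow> \<phi> x = 0))}"

definition has_L2_gradient ::
  "'a::euclidean_space set \<Rightarrow> ('a \<Rightarrow> real) \<Rightarrow> ('a \<Rightarrow> 'a) \<Rightarrow> bool" where
  "has_L2_gradient \<Omega> u G \<longleftrightarrow> u \<in> L2 \<Omega> \<and> G \<in> L2 \<Omega> \<and>
     (\<forall>\<phi>\<in>test_functions \<Omega>. \<forall>i\<in>Basis.
        L2_inner \<Omega> u (partial_deriv i \<phi>) = - L2_inner \<Omega> (\<lambda>x. G x \<bullet> i) \<phi>)"

definition H1 :: "'a::euclidean_space set \<Rightarrow> ('a \<Rightarrow> real) set" where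
  "H1 \<Omega> = {u. \<exists>G. has_L2_gradient \<Omega> u G}"

(* The weak gradient is unique up to null sets; this picks a representative. It is
   meaningful for u in H1 only. *)

definition weak_grad :: "'a::euclidean_space set \<Rightarrow> ('a \<Rightarrow> real) \<Rightarrow> 'a \<Rightarrow> 'a" where
  "weak_grad \<Omega> u = (SOME G. has_L2_gradient \<Omega> u G)"

(* Closure of the test functions in the H1 norm. *)

definition H10 :: "'a::euclidean_space set \<Rightarrow> ('a \<Rightarrow> real) set" where
  "H10 \<Omega> = {u \<in> H1 \<Omega>. \<exists>\<phi>. (\<forall>n::nat. \<phi> n \<in> test_functions \<Omega>) \<and>
     (\<lambda>n. L2_norm \<Omega> (\<lambda>x. u x - \<phi> n x)) \<longlonglongrightarrow> 0 \<and>
     (\<lambda>n. L2_norm \<Omega> (\<lambda>x. weak_grad \<Omega> u x - grad (\<phi> n) x)) \<longlonglongrightarrow> 0}"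

(* The distributional Laplacian of u is represented by the L2 function w. *)

definition has_L2_laplacian ::
  "'a::euclidean_space set \<Rightarrow> ('a \<Rightarrow> real) \<Rightarrow> ('a \<Rightarrow> real) \<Rightarrow> bool" where
  "has_L2_laplacian \<Omega> u w \<longleftrightarrow> u \<in> L2 \<Omega> \<and> w \<in> L2 \<Omega> \<and>
     (\<forall>\<phi>\<in>test_functions \<Omega>. L2_inner \<Omega> u (laplacian \<phi>) = L2_inner \<Omega> w \<phi>)"

end

(* Let e = u - ubar.  Testing with v = p and q = u gives <e, u> = -|p|^2/rho, hence
   |e|^2 + |p|^2/rho = -<e, ubar>, which yields (i) by Cauchy-Schwarz.  If ubar is in H10, the
   right-hand side is -<grad p, grad ubar>; testing with v = u, v = ubar and q = p gives
   |grad p|^2/rho + |grad u|^2 = <grad u, grad ubar>, which bounds |grad p| and yields (ii).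
   For (iii) the right-hand side becomes <p, Laplacian ubar> by approximating p with test
   functions, and Young's inequality absorbs |p|^2/rho. *)
theory Submission
  imports Defs
begin

section \<open>The inner product on L2\<close>

lemma L2_inner_commute: "L2_inner \<Omega> f g = L2_inner \<Omega> g f"
  by (simp add: L2_inner_def inner_commute)

lemma L2_inner_self_nonneg: "0 \<le> L2_inner \<Omega> f f"
  by (simp add: L2_inner_def)

lemma L2_norm_nonneg: "0 \<le> L2_norm \<Omega> f"
  by (simp add: L2_norm_def L2_inner_self_nonneg)

lemma L2_norm_power2: "(L2_norm \<Omega> f)\<^sup>2 = L2_inner \<Omega> f f"
  by (simp add: L2_norm_def L2_inner_self_nonneg)

text \<open>Domination: pointwise Cauchy-Schwarz followed by a crude Young inequality bounds the
  integrand by a sum of two integrable squares.\<close>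

lemma L2_inner_integrable:
  assumes "f \<in> L2 \<Omega>" "g \<in> L2 \<Omega>"
  shows "integrable (lebesgue_on \<Omega>) (\<lambda>x. f x \<bullet> g x)"
proof (rule Bochner_Integration.integrable_bound)
  show "integrable (lebesgue_on \<Omega>) (\<lambda>x. (norm (f x))\<^sup>2 + (norm (g x))\<^sup>2)"
    using assms by (auto simp: L2_def)
  show "(\<lambda>x. f x \<bullet> g x) \<in> borel_measurable (lebesgue_on \<Omega>)"
    using assms by (auto simp: L2_def)
  have "\<bar>f x \<bullet> g x\<bar> \<le> (norm (f x))\<^sup>2 + (norm (g x))\<^sup>2" for x
  proof -
    \<comment> \<open>Once expanded, this sum is twice the difference of the two sides of the bound
      below.\<close>
    have "0 \<le> (norm (f x) - norm (g x))\<^sup>2 + (norm (f x))\<^sup>2 + (norm (g x))\<^sup>2"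
      by simp
    then have "norm (f x) * norm (g x) \<le> (norm (f x))\<^sup>2 + (norm (g x))\<^sup>2"
      by (simp add: power2_diff)
    with Cauchy_Schwarz_ineq2[of "f x" "g x"] show ?thesis
      by linarith
  qed
  then show "AE x in lebesgue_on \<Omega>. norm (f x \<bullet> g x) \<le> norm ((norm (f x))\<^sup>2 + (norm (g x))\<^sup>2)"
    by simp
qed

lemma L2_diff:
  assumes "f \<in> L2 \<Omega>" "g \<in> L2 \<Omega>"
  shows "(\<lambda>x. f x - g x) \<in> L2 \<Omega>"
proof -
  have "integrable (lebesgue_on \<Omega>) (\<lambda>x. f x \<bullet> f x + g x \<bullet> g x - 2 * (f x \<bullet> g x))"
    using assms by (intro Bochner_Integration.integrable_add Bochner_Integration.integrable_diff
        integrable_mult_right L2_inner_integrable)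
  moreover have "f x \<bullet> f x + g x \<bullet> g x - 2 * (f x \<bullet> g x) = (norm (f x - g x))\<^sup>2" for x
    by (simp add: power2_norm_eq_inner inner_diff inner_commute)
  ultimately show ?thesis
    using assms by (auto simp: L2_def)
qed

lemma L2_inner_diff_right:
  assumes "f \<in> L2 \<Omega>" "g \<in> L2 \<Omega>" "h \<in> L2 \<Omega>"
  shows "L2_inner \<Omega> f (\<lambda>x. g x - h x) = L2_inner \<Omega> f g - L2_inner \<Omega> f h"
  using assms by (simp add: L2_inner_def inner_diff_right L2_inner_integrable)

text \<open>Discriminant argument for \<open>f + t g\<close>. Functions are not identified up to
  null sets, so the form is only semidefinite, and \<open>B = 0\<close> is a genuine case.\<close>

lemma L2_Cauchy_Schwarz:
  assumes f: "f \<in> L2 \<Omega>" and g: "g \<in> L2 \<Omega>"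
  shows "\<bar>L2_inner \<Omega> f g\<bar> \<le> L2_norm \<Omega> f * L2_norm \<Omega> g"
proof -
  define A B C where "A = L2_inner \<Omega> f f" and "B = L2_inner \<Omega> g g" and "C = L2_inner \<Omega> f g"
  have quadratic: "0 \<le> A + 2 * t * C + t\<^sup>2 * B" for t
  proof -
    have "0 \<le> (LINT x|lebesgue_on \<Omega>. (f x + t *\<^sub>R g x) \<bullet> (f x + t *\<^sub>R g x))"
      by simp
    also have "\<dots> = (LINT x|lebesgue_on \<Omega>. f x \<bullet> f x + (2 * t) * (f x \<bullet> g x) + t\<^sup>2 * (g x \<bullet> g x))"
      by (intro Bochner_Integration.integral_cong)
         (auto simp: inner_add inner_commute power2_eq_square algebra_simps)
    also have "\<dots> = A + 2 * t * C + t\<^sup>2 * B"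
      using f g by (simp add: A_def B_def C_def L2_inner_def L2_inner_integrable)
    finally show ?thesis .
  qed
  have "C\<^sup>2 \<le> A * B"
  proof (cases "B = 0")
    case True
    have "C = 0"
    proof (rule ccontr)
      assume "C \<noteq> 0"
      \<comment> \<open>With \<open>B = 0\<close> the quadratic is affine in \<open>t\<close>; this
        \<open>t\<close> gives it the value \<open>-1\<close>.\<close>
      with quadratic[of "- (A + 1) / (2 * C)"] True show False
        by (simp add: field_simps)
    qed
    with True show ?thesis by simp
  next
    case False
    then have "B > 0"
      using L2_inner_self_nonneg[of \<Omega> g] by (simp add: B_def)
    \<comment> \<open>The minimiser of the quadratic, where its value is
      \<open>A - C^2 / B\<close>.\<close>
    with quadratic[of "- C / B"] show ?thesis
      by (simp add: field_simps power2_eq_square)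
  qed
  then have "\<bar>C\<bar> \<le> sqrt (A * B)"
    by (simp add: real_le_rsqrt)
  then show ?thesis
    by (simp add: A_def B_def C_def L2_norm_def real_sqrt_mult)
qed

text \<open>By Cauchy-Schwarz the inner product is continuous in its second argument; this carries
  identities from test functions over to \<open>H10\<close>.\<close>

lemma L2_inner_tendsto:
  assumes f: "f \<in> L2 \<Omega>" and g: "g \<in> L2 \<Omega>" and h: "\<And>n. h n \<in> L2 \<Omega>"
    and lim: "(\<lambda>n. L2_norm \<Omega> (\<lambda>x. g x - h n x)) \<longlonglongrightarrow> 0"
  shows "(\<lambda>n. L2_inner \<Omega> f (h n)) \<longlonglongrightarrow> L2_inner \<Omega> f g"
proof -
  have bound_lim: "(\<lambda>n. L2_norm \<Omega> f * L2_norm \<Omega> (\<lambda>x. g x - h n x)) \<longlonglongrightarrow> 0"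
    using tendsto_mult_left[OF lim, of "L2_norm \<Omega> f"] by simp
  have "norm (L2_inner \<Omega> f g - L2_inner \<Omega> f (h n))
      \<le> L2_norm \<Omega> f * L2_norm \<Omega> (\<lambda>x. g x - h n x)" for n
    using L2_Cauchy_Schwarz[OF f L2_diff[OF g h]] by (simp add: L2_inner_diff_right f g h)
  then have "(\<lambda>n. L2_inner \<Omega> f g - L2_inner \<Omega> f (h n)) \<longlonglongrightarrow> 0"
    by (intro Lim_null_comparison[OF always_eventually[OF allI] bound_lim])
  from tendsto_diff[OF tendsto_const[of "L2_inner \<Omega> f g"] this] show ?thesis
    by simp
qed

section \<open>Test functions\<close>

lemma partial_deriv_test_function:
  assumes "\<phi> \<in> test_functions \<Omega>" "i \<in> Basis"
  shows "partial_deriv i \<phi> \<in> test_functions \<Omega>"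
proof -
  obtain K where K: "compact K" "K \<subseteq> \<Omega>" "\<And>x. x \<notin> K \<Longrightarrow> \<phi> x = 0"
    and Ck: "\<And>k. Ck k \<phi>"
    using assms(1) by (auto simp: test_functions_def)
  have "Ck k (partial_deriv i \<phi>)" for k
    using Ck[of "Suc k"] assms(2) by simp
  moreover have "partial_deriv i \<phi> x = 0" if "x \<notin> K" for x
  proof -
    \<comment> \<open>The complement of the compact \<open>K\<close> is open, so near
      \<open>x\<close> the function coincides with the constant 0.\<close>
    have "(\<phi> has_derivative (\<lambda>_. 0)) (at x)"
      using K that
      by (intro has_derivative_transform_within_open[OF has_derivative_const[of 0], of "- K"])
         (auto simp: compact_imp_closed open_Compl)
    then show ?thesis
      using frechet_derivative_at[of \<phi> "\<lambda>_. 0" x] by (metis partial_deriv_def)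
  qed
  ultimately show ?thesis
    using K by (auto simp: test_functions_def)
qed

text \<open>Such a function is bounded, and a bounded measurable function is square integrable on a
  set of finite measure.\<close>

lemma continuous_compact_support_in_L2:
  fixes f :: "'a::euclidean_space \<Rightarrow> 'b::euclidean_space"
  assumes cont: "continuous_on UNIV f" and K: "compact K" "\<And>x. x \<notin> K \<Longrightarrow> f x = 0"
    and \<Omega>: "\<Omega> \<in> lmeasurable"
  shows "f \<in> L2 \<Omega>"
proof -
  obtain M where M: "\<And>x. x \<in> K \<Longrightarrow> norm (f x) \<le> M"
    using compact_imp_bounded[OF compact_continuous_image[OF continuous_on_subset[OF cont] K(1)]]
    by (auto simp: bounded_iff)
  \<comment> \<open>If \<open>K\<close> is empty, \<open>M\<close> is arbitrary and may be negative;
    the maximum with 0 also covers points off \<open>K\<close>.\<close>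
  have bound: "norm (f x) \<le> max M 0" for x
    using M[of x] K(2)[of x] by (cases "x \<in> K") auto
  have meas: "f \<in> borel_measurable (lebesgue_on \<Omega>)"
    using borel_measurable_continuous_onI[OF cont]
    by (intro measurable_restrict_space1 measurable_completion) simp
  interpret finite_measure "lebesgue_on \<Omega>"
    by (rule finite_measure_lebesgue_on[OF \<Omega>])
  have "integrable (lebesgue_on \<Omega>) (\<lambda>x. (norm (f x))\<^sup>2)"
    using meas bound
    by (intro integrable_const_bound[where B = "(max M 0)\<^sup>2"]) (auto intro!: power_mono)
  with meas show ?thesis by (simp add: L2_def)
qed

lemma test_function_in_L2:
  assumes "\<phi> \<in> test_functions \<Omega>" "\<Omega> \<in> lmeasurable"
  shows "\<phi> \<in> L2 \<Omega>"
proof -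
  obtain K where "compact K" "\<And>x. x \<notin> K \<Longrightarrow> \<phi> x = 0" "Ck 0 \<phi>"
    using assms(1) unfolding test_functions_def by blast
  with assms(2) show ?thesis
    by (intro continuous_compact_support_in_L2[of \<phi> K]) auto
qed

lemma L2_scaleR_const:
  fixes f :: "'a::euclidean_space \<Rightarrow> real"
  assumes "f \<in> L2 \<Omega>"
  shows "(\<lambda>x. f x *\<^sub>R c) \<in> L2 \<Omega>"
  using assms by (auto simp: L2_def power_mult_distrib)

lemma L2_sum:
  assumes "\<And>i. i \<in> I \<Longrightarrow> f i \<in> L2 \<Omega>"
  shows "(\<lambda>x. \<Sum>i\<in>I. f i x) \<in> L2 \<Omega>"
  using assms
proof (induction I rule: infinite_finite_induct)
  case (insert i I)
  \<comment> \<open>The sum is written as \<open>f - (0 - g)\<close>, so that closure under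
    differences suffices.\<close>
  have "(\<lambda>x. f i x - ((\<lambda>x. 0) x - (\<Sum>j\<in>I. f j x))) \<in> L2 \<Omega>"
    using insert by (intro L2_diff) (auto simp: L2_def)
  with insert show ?case by simp
qed (auto simp: L2_def)

lemma grad_in_L2:
  assumes "\<phi> \<in> test_functions \<Omega>" "\<Omega> \<in> lmeasurable"
  shows "grad \<phi> \<in> L2 \<Omega>"
proof -
  have "(\<lambda>x. \<Sum>i\<in>Basis. partial_deriv i \<phi> x *\<^sub>R i) \<in> L2 \<Omega>"
    using assms
    by (intro L2_sum L2_scaleR_const test_function_in_L2 partial_deriv_test_function)
  then show ?thesis
    by (simp add: grad_def[abs_def])
qed

section \<open>Weak gradients\<close>

lemma has_L2_gradient_weak_grad:
  assumes "u \<in> H1 \<Omega>"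
  shows "has_L2_gradient \<Omega> u (weak_grad \<Omega> u)"
  using assms unfolding H1_def weak_grad_def mem_Collect_eq by (rule someI_ex)

lemma weak_grad_in_L2:
  assumes "u \<in> H10 \<Omega>"
  shows "weak_grad \<Omega> u \<in> L2 \<Omega>"
  using assms has_L2_gradient_weak_grad by (auto simp: H10_def has_L2_gradient_def)

lemma H10_in_L2:
  assumes "u \<in> H10 \<Omega>"
  shows "u \<in> L2 \<Omega>"
  using assms has_L2_gradient_weak_grad by (auto simp: H10_def has_L2_gradient_def)

text \<open>Each \<open>partial_deriv i \<phi>\<close> is itself a test function, so it may be used
  in direction \<open>i\<close> in the definition of the weak gradient; summing over
  \<open>i\<close> produces the Laplacian.\<close>

lemma L2_inner_gradient_grad:
  assumes \<Omega>: "\<Omega> \<in> lmeasurable" and G: "has_L2_gradient \<Omega> u G" and \<phi>: "\<phi> \<in> test_functions \<Omega>"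
  shows "L2_inner \<Omega> G (grad \<phi>) = - L2_inner \<Omega> u (laplacian \<phi>)"
proof -
  note d = partial_deriv_test_function[OF \<phi>]
  have u: "u \<in> L2 \<Omega>" and GL2: "G \<in> L2 \<Omega>"
    using G by (auto simp: has_L2_gradient_def)
  have int_G: "integrable (lebesgue_on \<Omega>) (\<lambda>x. (G x \<bullet> i) * partial_deriv i \<phi> x)"
    if "i \<in> Basis" for i
    \<comment> \<open>The scalar product of components is read as the inner product of
      \<open>G\<close> with the vector field \<open>partial_deriv i \<phi>\<close> times
      \<open>i\<close>.\<close>
    using L2_inner_integrable[OF GL2 L2_scaleR_const[OF test_function_in_L2[OF d[OF that] \<Omega>], of i]]
    by (simp add: mult.commute)
  have int_u: "integrable (lebesgue_on \<Omega>) (\<lambda>x. u x * partial_deriv i (partial_deriv i \<phi>) x)"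
    if "i \<in> Basis" for i
    using L2_inner_integrable[OF u test_function_in_L2[OF
          partial_deriv_test_function[OF d[OF that] that] \<Omega>]]
    by simp
  have "L2_inner \<Omega> G (grad \<phi>)
      = (LINT x|lebesgue_on \<Omega>. (\<Sum>i\<in>Basis. (G x \<bullet> i) * partial_deriv i \<phi> x))"
    by (simp add: L2_inner_def grad_def inner_sum_right mult.commute)
  also have "\<dots> = (\<Sum>i\<in>Basis. L2_inner \<Omega> (\<lambda>x. G x \<bullet> i) (partial_deriv i \<phi>))"
    using int_G by (simp add: L2_inner_def)
  also have "\<dots> = (\<Sum>i\<in>Basis. - L2_inner \<Omega> u (partial_deriv i (partial_deriv i \<phi>)))"
    using G d by (intro sum.cong) (auto simp: has_L2_gradient_def)
  also have "\<dots> = - L2_inner \<Omega> u (laplacian \<phi>)"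
    using int_u by (simp add: L2_inner_def laplacian_def sum_distrib_left sum_negf)
  finally show ?thesis .
qed

text \<open>Green's formula without boundary term, as \<open>p\<close> has zero boundary values. It
  holds for the test functions approximating \<open>p\<close>, and both sides pass to the limit: the
  left by convergence of gradients, the right by convergence of values.\<close>

lemma Green_H10:
  assumes \<Omega>: "\<Omega> \<in> lmeasurable" and u: "u \<in> H1 \<Omega>" and w: "has_L2_laplacian \<Omega> u w"
    and p: "p \<in> H10 \<Omega>"
  shows "L2_inner \<Omega> (weak_grad \<Omega> u) (weak_grad \<Omega> p) = - L2_inner \<Omega> w p"
proof -
  obtain \<phi> where \<phi>: "\<And>n::nat. \<phi> n \<in> test_functions \<Omega>"
    and lim: "(\<lambda>n. L2_norm \<Omega> (\<lambda>x. p x - \<phi> n x)) \<longlonglongrightarrow> 0"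
    and lim_grad: "(\<lambda>n. L2_norm \<Omega> (\<lambda>x. weak_grad \<Omega> p x - grad (\<phi> n) x)) \<longlonglongrightarrow> 0"
    using p by (auto simp: H10_def)
  note G = has_L2_gradient_weak_grad[OF u]
  then have G_L2: "weak_grad \<Omega> u \<in> L2 \<Omega>"
    by (simp add: has_L2_gradient_def)
  have w_L2: "w \<in> L2 \<Omega>"
    using w by (simp add: has_L2_laplacian_def)
  have "L2_inner \<Omega> (weak_grad \<Omega> u) (grad (\<phi> n)) = - L2_inner \<Omega> w (\<phi> n)" for n
    using L2_inner_gradient_grad[OF \<Omega> G \<phi>] w \<phi> by (simp add: has_L2_laplacian_def)
  moreover have "(\<lambda>n. L2_inner \<Omega> (weak_grad \<Omega> u) (grad (\<phi> n)))
      \<longlonglongrightarrow> L2_inner \<Omega> (weak_grad \<Omega> u) (weak_grad \<Omega> p)"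
    by (rule L2_inner_tendsto[OF G_L2 weak_grad_in_L2[OF p] grad_in_L2[OF \<phi> \<Omega>] lim_grad])
  moreover have "(\<lambda>n. - L2_inner \<Omega> w (\<phi> n)) \<longlonglongrightarrow> - L2_inner \<Omega> w p"
    by (intro tendsto_minus
        L2_inner_tendsto[OF w_L2 H10_in_L2[OF p] test_function_in_L2[OF \<phi> \<Omega>] lim])
  ultimately show ?thesis
    by (auto intro: LIMSEQ_unique)
qed

section \<open>The error estimates\<close>

theorem lemma1:
  fixes \<Omega> :: "(real ^ 'd) set" and \<rho> :: real and ubar u p :: "real ^ 'd \<Rightarrow> real"
  assumes "CARD('d) \<in> {1, 2, 3}"
    and "bounded_lipschitz_domain \<Omega>"
    and "\<rho> > 0"
    and "ubar \<in> L2 \<Omega>"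
    and "u \<in> H10 \<Omega>" and "p \<in> H10 \<Omega>"
    and "\<forall>v\<in>H10 \<Omega>.
           1 / \<rho> * L2_inner \<Omega> p v + L2_inner \<Omega> (weak_grad \<Omega> u) (weak_grad \<Omega> v) = 0"
    and "\<forall>q\<in>H10 \<Omega>.
           L2_inner \<Omega> (weak_grad \<Omega> p) (weak_grad \<Omega> q) = L2_inner \<Omega> (\<lambda>x. u x - ubar x) q"
  shows "L2_norm \<Omega> (\<lambda>x. u x - ubar x) \<le> L2_norm \<Omega> ubar \<and>
         (ubar \<in> H10 \<Omega> \<longrightarrow>
           L2_norm \<Omega> (\<lambda>x. u x - ubar x) \<le> \<rho> powr (1/4) * L2_norm \<Omega> (weak_grad \<Omega> ubar)) \<and>
         (\<forall>w. ubar \<in> H10 \<Omega> \<and> has_L2_laplacian \<Omega> ubar w \<longrightarrow>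
           L2_norm \<Omega> (\<lambda>x. u x - ubar x) \<le> \<rho> powr (1/2) * L2_norm \<Omega> w)"
proof -
  define e where "e = (\<lambda>x. u x - ubar x)"
  define E P where "E = L2_norm \<Omega> e" and "P = L2_norm \<Omega> p"
  note state = assms(7)[rule_format] and adjoint = assms(8)[rule_format, folded e_def]
  have \<Omega>: "\<Omega> \<in> lmeasurable"
    using assms(2) by (auto simp: bounded_lipschitz_domain_def intro: lmeasurable_open)
  have uL2: "u \<in> L2 \<Omega>" and pL2: "p \<in> L2 \<Omega>"
    using assms(5,6) by (auto intro: H10_in_L2)
  have eL2: "e \<in> L2 \<Omega>"
    unfolding e_def by (rule L2_diff[OF uL2 assms(4)])
  have E0: "0 \<le> E" and P0: "0 \<le> P"
    by (auto simp: E_def P_def L2_norm_nonneg)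
  have "L2_inner \<Omega> e u = - (P\<^sup>2 / \<rho>)"
    using state[OF assms(6)] adjoint[OF assms(5)]
    by (simp add: L2_inner_commute[of _ "weak_grad \<Omega> p"] P_def L2_norm_power2)
  moreover have "L2_inner \<Omega> e e = L2_inner \<Omega> e u - L2_inner \<Omega> e ubar"
    using L2_inner_diff_right[OF eL2 uL2 assms(4)] by (simp flip: e_def)
  \<comment> \<open>The identity shared by all three estimates; they differ in how its right-hand
    side is bounded.\<close>
  ultimately have energy: "E\<^sup>2 + P\<^sup>2 / \<rho> = - L2_inner \<Omega> e ubar"
    by (simp add: E_def L2_norm_power2)
  have "E \<le> L2_norm \<Omega> ubar"
  proof -
    have "0 \<le> P\<^sup>2 / \<rho>" using assms(3) by simp
    with energy L2_Cauchy_Schwarz[OF eL2 assms(4)]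
    have "E * E \<le> E * L2_norm \<Omega> ubar"
      by (simp add: E_def power2_eq_square)
    \<comment> \<open>One factor \<open>E\<close> is cancelled unless it is zero, when the claim is
      trivial.\<close>
    with E0 L2_norm_nonneg[of \<Omega> ubar] show ?thesis
      by (cases "E = 0") auto
  qed
  moreover have "E \<le> \<rho> powr (1/4) * L2_norm \<Omega> (weak_grad \<Omega> ubar)" if ubar: "ubar \<in> H10 \<Omega>"
  proof -
    define U Q B where "U = L2_norm \<Omega> (weak_grad \<Omega> u)" and "Q = L2_norm \<Omega> (weak_grad \<Omega> p)"
      and "B = L2_norm \<Omega> (weak_grad \<Omega> ubar)"
    have Q0: "0 \<le> Q" and B0: "0 \<le> B"
      by (auto simp: Q_def B_def L2_norm_nonneg)
    \<comment> \<open>The adjoint equation with \<open>q = ubar\<close> rewrites the right-hand side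
      of \<open>energy\<close>; the term in \<open>P\<close> is dropped.\<close>
    have E2: "E\<^sup>2 \<le> Q * B"
    proof -
      have "0 \<le> P\<^sup>2 / \<rho>" using assms(3) by simp
      with energy adjoint[OF ubar]
        L2_Cauchy_Schwarz[OF weak_grad_in_L2[OF assms(6)] weak_grad_in_L2[OF ubar]]
      show ?thesis by (simp add: Q_def B_def)
    qed
    have "L2_inner \<Omega> p u - L2_inner \<Omega> p ubar = L2_inner \<Omega> e p"
      using L2_inner_diff_right[OF pL2 uL2 assms(4)] by (simp add: e_def L2_inner_commute)
    also have "\<dots> = Q\<^sup>2"
      using adjoint[OF assms(6)] by (simp add: Q_def L2_norm_power2)
    finally have "Q\<^sup>2 / \<rho> = L2_inner \<Omega> p u / \<rho> - L2_inner \<Omega> p ubar / \<rho>"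
      by (simp flip: diff_divide_distrib)
    \<comment> \<open>The state equation with \<open>v = u\<close> and with \<open>v = ubar\<close>
      turns the two quotients into \<open>-U^2\<close> and minus the product of
      \<open>weak_grad \<Omega> u\<close> and \<open>weak_grad \<Omega> ubar\<close>.\<close>
    then have "Q\<^sup>2 / \<rho> + U\<^sup>2 \<le> U * B"
      using state[OF assms(5)] state[OF ubar]
        L2_Cauchy_Schwarz[OF weak_grad_in_L2[OF assms(5)] weak_grad_in_L2[OF ubar]]
      by (simp add: U_def B_def L2_norm_power2)
    \<comment> \<open>Young without the factor 1/2: \<open>U^2\<close> cancels and the constant in
      front of \<open>B^2\<close> is still 1.\<close>
    moreover have "U * B \<le> U\<^sup>2 + B\<^sup>2"
      using zero_le_power2[of "U - B"] zero_le_power2[of U] zero_le_power2[of B]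
      unfolding power2_diff by linarith
    ultimately have "Q\<^sup>2 / \<rho> \<le> B\<^sup>2"
      by linarith
    then have "Q\<^sup>2 \<le> \<rho> * B\<^sup>2"
      using assms(3) by (simp add: field_simps)
    then have "Q \<le> sqrt \<rho> * B"
      using B0 real_le_rsqrt[of Q "\<rho> * B\<^sup>2"] by (simp add: real_sqrt_mult)
    then have "Q * B \<le> sqrt \<rho> * B\<^sup>2"
      using mult_right_mono[OF _ B0, of Q "sqrt \<rho> * B"] by (simp add: power2_eq_square mult.assoc)
    \<comment> \<open>Taking the root of \<open>E^2\<close> halves the exponent 1/2 to 1/4.\<close>
    also have "sqrt \<rho> = (\<rho> powr (1/4))\<^sup>2"
      using assms(3) powr_half_sqrt[of \<rho>] by (simp add: powr_power)
    finally have "E\<^sup>2 \<le> (\<rho> powr (1/4) * B)\<^sup>2"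
      using E2 by (simp add: power_mult_distrib)
    then show ?thesis
      unfolding B_def[symmetric] by (rule power2_le_imp_le) (simp add: B0)
  qed
  moreover have "E \<le> \<rho> powr (1/2) * L2_norm \<Omega> w"
    if ubar: "ubar \<in> H10 \<Omega>" and w: "has_L2_laplacian \<Omega> ubar w" for w
  proof -
    define W where "W = L2_norm \<Omega> w"
    have W0: "0 \<le> W" by (simp add: W_def L2_norm_nonneg)
    have wL2: "w \<in> L2 \<Omega>" and "ubar \<in> H1 \<Omega>"
      using w ubar by (auto simp: has_L2_laplacian_def H10_def)
    \<comment> \<open>The minus sign from Green's formula cancels the one in
      \<open>energy\<close>.\<close>
    from Green_H10[OF \<Omega> this(2) w assms(6)] adjoint[OF ubar] energy
    have "E\<^sup>2 + P\<^sup>2 / \<rho> = L2_inner \<Omega> w p"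
      by (simp add: L2_inner_commute)
    then have "E\<^sup>2 + P\<^sup>2 / \<rho> \<le> P * W"
      using L2_Cauchy_Schwarz[OF wL2 pL2] by (simp add: P_def W_def mult.commute)
    \<comment> \<open>Young weighted by \<open>\<rho>\<close>, so that the first term is exactly the
      one on the left of the energy bound.\<close>
    moreover have "P * W \<le> P\<^sup>2 / \<rho> + \<rho> * W\<^sup>2"
    proof -
      have "0 \<le> (P - \<rho> * W)\<^sup>2 + P * (\<rho> * W)"
        using P0 W0 assms(3) by simp
      then have "\<rho> * (P * W) \<le> P\<^sup>2 + \<rho> * (\<rho> * W\<^sup>2)"
        by (simp add: power2_eq_square algebra_simps)
      then show ?thesis
        using assms(3) by (simp add: field_simps)
    qed
    ultimately have "E\<^sup>2 \<le> (sqrt \<rho> * W)\<^sup>2"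
      using assms(3) by (simp add: power_mult_distrib)
    then show ?thesis
      using W0 assms(3) power2_le_imp_le[of E "sqrt \<rho> * W"]
      by (simp add: powr_half_sqrt flip: W_def)
  qed
  ultimately show ?thesis
    by (auto simp: E_def e_def)
qed

end
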